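(* Let $X$ be an infinite Hausdorff space of countable tightness. Then the following conditions are equivalent: (a) $X$ is totally disconnected and $\mathscr{F}(X)$ has a continuous selection; (b) $\mathscr{F}(X\setminus S)$ has a continuous selection for every nonempty subset $S\subset X$ with $|S|\leq 2$.
   Context: A space $X$ is totally disconnected here if each singleton of $X$ is an intersection of clopen subsets of $X$. A space $X$ is of countable tightness if for each $A\subset X$ and $x\in\overline{A}$ there is a countable set $B\subset A$ with $x\in\overline{B}$. For a topological space $Z$, $\mathscr{F}(Z)$ is the set of all nonempty closed subsets of $Z$, endowed with the Vietoris topology, i.e. the topology generated by all collections $\langle\mathscr{V}\rangle=\{S\in\mathscr{F}(Z): S\subset\bigcup\mathscr{V}\text{ and }S\cap V\neq\varnothing\text{ for every }V\in\mathscr{V}\}$, where $\mathscr{V}$ runs over the finite families of open subsets of $Z$. The set $X\setminus S$ carries the subspace topology. A selection for $\mathscr{F}(Z)$ is a map $f:\mathscr{F}(Z)\to Z$ with $f(T)\in T$ for all $T\in\mathscr{F}(Z)$; it is continuous if it is continuous with respect to the Vietoris topology on $\mathscr{F}(Z)$. *)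

theory Defs
  imports "HOL-Analysis.Analysis"
begin

text \<open>This is stronger than having only singletons as connected components (the more common
  use of the term).\<close>
definition totally_disconnected_space :: "'a topology \<Rightarrow> bool" where
  "totally_disconnected_space X \<longleftrightarrow>
     (\<forall>x \<in> topspace X. \<exists>\<C>. \<C> \<noteq> {} \<and> (\<forall>U \<in> \<C>. openin X U \<and> closedin X U) \<and> {x} = \<Inter>\<C>)"

definition countably_tight_space :: "'a topology \<Rightarrow> bool" where
  "countably_tight_space X \<longleftrightarrow>
     (\<forall>A x. A \<subseteq> topspace X \<and> x \<in> X closure_of A \<longrightarrow>
        (\<exists>B. B \<subseteq> A \<and> countable B \<and> x \<in> X closure_of B))"

definition closed_hyperspace :: "'a topology \<Rightarrow> 'a set set" where
  "closed_hyperspace Z = {S. closedin Z S \<and> S \<noteq> {}}"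

definition vietoris_set :: "'a topology \<Rightarrow> 'a set set \<Rightarrow> 'a set set" where
  "vietoris_set Z \<V> = {S \<in> closed_hyperspace Z. S \<subseteq> \<Union>\<V> \<and> (\<forall>V \<in> \<V>. S \<inter> V \<noteq> {})}"

definition vietoris_topology :: "'a topology \<Rightarrow> 'a set topology" where
  "vietoris_topology Z =
     topology_generated_by {vietoris_set Z \<V> | \<V>. finite \<V> \<and> (\<forall>V \<in> \<V>. openin Z V)}"

lemma topspace_vietoris_topology [simp]:
  "topspace (vietoris_topology Z) = closed_hyperspace Z"
proof -
  have "closed_hyperspace Z = vietoris_set Z {topspace Z}"
    by (auto simp: closed_hyperspace_def vietoris_set_def dest: closedin_subset)
  moreover have "vietoris_set Z \<V> \<subseteq> closed_hyperspace Z" for \<V>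
    by (auto simp: vietoris_set_def)
  moreover have "finite {topspace Z} \<and> (\<forall>V \<in> {topspace Z}. openin Z V)"
    by simp
  ultimately show ?thesis
    unfolding vietoris_topology_def topology_generated_by_topspace by blast
qed

definition has_continuous_selection :: "'a topology \<Rightarrow> bool" where
  "has_continuous_selection Z \<longleftrightarrow>
     (\<exists>f. continuous_map (vietoris_topology Z) Z f \<and> (\<forall>T \<in> closed_hyperspace Z. f T \<in> T))"

end

theory Submission
  imports Defs
begin

text \<open>
  A continuous selection \<open>f\<close> orders \<open>Z\<close> by \<open>x < y\<close> iff \<open>f {x, y} = x\<close>, and all rays of this (in general
  not transitive) relation are open.

  If \<open>X\<close> is totally disconnected, let \<open>p\<close> be in the closure of a countable set \<open>A\<close> of points below \<open>p\<close>.
  For \<open>a \<in> A\<close>, a clopen set containing \<open>p\<close> but not \<open>a\<close> stays clopen when cut down to the points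
  above \<open>a\<close>, and no point below \<open>p\<close> lies above all of \<open>A\<close>. Hence \<open>X - {p}\<close>, and therefore
  \<open>X - S\<close> for every finite \<open>S\<close>, is a countable union of clopen sets \<open>D n\<close>; select from \<open>T \<inter> D n\<close>
  for the least \<open>n\<close> for which it is nonempty.

  Conversely, if two points \<open>a\<close>, \<open>b\<close> cannot be separated by a clopen set, then some interval of such an
  order is a connected set \<open>J\<close> with at least two points, closed in some \<open>X - {p}\<close>. An open interval
  \<open>(x, y)\<close> of \<open>J\<close> is connected and all its points are cut points; but on finite subsets of a
  connected space \<open>M\<close> a selection is the minimum, so by density \<open>f M\<close> is the least point of \<open>M\<close>,
  which is not a cut point. So \<open>(x, y)\<close> is not closed in \<open>X - {x, y}\<close>, that is, \<open>p\<close> is in the closure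
  of every such interval. But then the ordered space \<open>(J \<union> {p}) - {z}\<close> has no cut point in \<open>J\<close>,
  although one of any three points in an ordered space is a cut point. Once \<open>X\<close> is known to be
  totally disconnected, it splits into two clopen sets, each of which misses some point.
\<close>


section \<open>The Vietoris topology\<close>

lemma openin_vietoris_subset:
  assumes "openin Z U"
  shows "openin (vietoris_topology Z) {T \<in> closed_hyperspace Z. T \<subseteq> U}"
proof -
  have "{T \<in> closed_hyperspace Z. T \<subseteq> U} = vietoris_set Z {U}"
    by (auto simp: vietoris_set_def closed_hyperspace_def)
  then show ?thesis
    unfolding vietoris_topology_def using assms
    by (auto intro!: topology_generated_by_Basis)
qed

lemma openin_vietoris_meets:
  assumes "openin Z U"
  shows "openin (vietoris_topology Z) {T \<in> closed_hyperspace Z. T \<inter> U \<noteq> {}}"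
proof -
  have "{T \<in> closed_hyperspace Z. T \<inter> U \<noteq> {}} = vietoris_set Z {U, topspace Z}"
    using closedin_subset by (fastforce simp: vietoris_set_def closed_hyperspace_def)
  moreover have "finite {U, topspace Z} \<and> (\<forall>V \<in> {U, topspace Z}. openin Z V)"
    using assms by auto
  ultimately show ?thesis
    unfolding vietoris_topology_def by (intro topology_generated_by_Basis) blast
qed

text \<open>For a nonempty finite family, \<open>vietoris_set Z \<V>\<close> is one condition
  \<open>T \<subseteq> \<Union>\<V>\<close> together with finitely many conditions
  \<open>T \<inter> V \<noteq> {}\<close>; for the empty family it is empty. Preimages of these two
  kinds of sets therefore suffice.\<close>

lemma continuous_map_into_vietoris:
  assumes maps: "\<And>x. x \<in> topspace X \<Longrightarrow> g x \<in> closed_hyperspace Z"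
    and sub: "\<And>U. openin Z U \<Longrightarrow> openin X {x \<in> topspace X. g x \<subseteq> U}"
    and meets: "\<And>U. openin Z U \<Longrightarrow> openin X {x \<in> topspace X. g x \<inter> U \<noteq> {}}"
  shows "continuous_map X (vietoris_topology Z) g"
  unfolding vietoris_topology_def
proof (rule continuous_on_generated_topo)
  fix W assume "W \<in> {vietoris_set Z \<V> |\<V>. finite \<V> \<and> (\<forall>V\<in>\<V>. openin Z V)}"
  then obtain \<V> where W: "W = vietoris_set Z \<V>" "finite \<V>" "\<And>V. V \<in> \<V> \<Longrightarrow> openin Z V"
    by blast
  have "g -` W \<inter> topspace X = {x \<in> topspace X. g x \<subseteq> \<Union>\<V>} \<inter>
      (\<Inter>V\<in>\<V>. {x \<in> topspace X. g x \<inter> V \<noteq> {}} ) "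
    if "\<V> \<noteq> {}"
    using maps that unfolding W(1) vietoris_set_def by auto
  moreover have "g -` W \<inter> topspace X = {}" if "\<V> = {}"
    using maps that unfolding W(1) vietoris_set_def closed_hyperspace_def by auto
  moreover have "openin X ({x \<in> topspace X. g x \<subseteq> \<Union>\<V>} \<inter>
      (\<Inter>V\<in>\<V>. {x \<in> topspace X. g x \<inter> V \<noteq> {}} ))" if "\<V> \<noteq> {}"
    using W that by (intro openin_Int openin_INT2 sub meets openin_Union) auto
  ultimately show "openin X (g -` W \<inter> topspace X)"
    by (cases "\<V> = {}") auto
next
  have "\<Union> {vietoris_set Z \<V> |\<V>. finite \<V> \<and> (\<forall>V\<in>\<V>. openin Z V)} = closed_hyperspace Z"
    using topspace_vietoris_topology[of Z] unfolding vietoris_topology_def topology_generated_by_topspace .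
  then show "g ` topspace X \<subseteq> \<Union> {vietoris_set Z \<V> |\<V>. finite \<V> \<and> (\<forall>V\<in>\<V>. openin Z V)}"
    using maps by auto
qed

section \<open>Selections on closed subspaces and clopen unions\<close>

text \<open>Closed subsets of a closed \<open>C\<close> are closed in \<open>Z\<close>, so the
  inclusion of hyperspaces is defined and continuous, and the selection can be restricted along
  it.\<close>

lemma has_continuous_selection_closed_subspace:
  assumes "has_continuous_selection Z" "closedin Z C"
  shows "has_continuous_selection (subtopology Z C)"
proof -
  obtain f where f: "continuous_map (vietoris_topology Z) Z f"
    "\<And>T. T \<in> closed_hyperspace Z \<Longrightarrow> f T \<in> T"
    using assms(1) unfolding has_continuous_selection_def by blast
  have hyp: "closed_hyperspace (subtopology Z C) = {T \<in> closed_hyperspace Z. T \<subseteq> C}"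
    using assms(2) by (auto simp: closed_hyperspace_def closedin_closed_subtopology)
  have "continuous_map (vietoris_topology (subtopology Z C)) (vietoris_topology Z) (\<lambda>T. T)"
  proof (rule continuous_map_into_vietoris)
    fix U assume U: "openin Z U"
    then have o: "openin (subtopology Z C) (U \<inter> C)"
      by (auto simp: openin_subtopology)
    have "{T \<in> topspace (vietoris_topology (subtopology Z C)). T \<subseteq> U}
        = {T \<in> closed_hyperspace (subtopology Z C). T \<subseteq> U \<inter> C}"
      "{T \<in> topspace (vietoris_topology (subtopology Z C)). T \<inter> U \<noteq> {}}
        = {T \<in> closed_hyperspace (subtopology Z C). T \<inter> (U \<inter> C) \<noteq> {}}"
      by (auto simp: hyp)
    then show "openin (vietoris_topology (subtopology Z C))
            {T \<in> topspace (vietoris_topology (subtopology Z C)). T \<subseteq> U}"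
      and "openin (vietoris_topology (subtopology Z C))
            {T \<in> topspace (vietoris_topology (subtopology Z C)). T \<inter> U \<noteq> {}}"
      using openin_vietoris_subset[OF o] openin_vietoris_meets[OF o] by simp_all
  qed (simp add: hyp)
  then have "continuous_map (vietoris_topology (subtopology Z C)) Z f"
    using continuous_map_compose[OF _ f(1)] by (auto simp: o_def)
  then have "continuous_map (vietoris_topology (subtopology Z C)) (subtopology Z C) f"
    using f(2) hyp by (auto simp: continuous_map_in_subtopology)
  then show ?thesis
    unfolding has_continuous_selection_def using f(2) hyp by auto
qed

text \<open>The least \<open>n\<close> with \<open>T \<inter> D n\<close> nonempty is locally
  constant in \<open>T\<close>: the sets \<open>A n\<close> are open and partition the hyperspace.
  On \<open>A n\<close> the new selection is \<open>f n\<close> applied to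
  \<open>T \<inter> D n\<close>, which depends continuously on \<open>T\<close>. The
  \<open>D n\<close> may overlap or be empty.\<close>

lemma has_continuous_selection_countable_clopen_cover:
  fixes D :: "nat \<Rightarrow> 'a set"
  assumes clopen: "\<And>n. openin Z (D n)" "\<And>n. closedin Z (D n)"
    and cover: "topspace Z = (\<Union>n. D n)"
    and sel: "\<And>n. has_continuous_selection (subtopology Z (D n))"
  shows "has_continuous_selection Z"
proof -
  obtain f where f: "\<And>n. continuous_map (vietoris_topology (subtopology Z (D n))) (subtopology Z (D n)) (f n)"
    "\<And>n T. T \<in> closed_hyperspace (subtopology Z (D n)) \<Longrightarrow> f n T \<in> T"
    using sel unfolding has_continuous_selection_def by metis
  define first where "first T = (LEAST n. T \<inter> D n \<noteq> {})" for T
  define h where "h T = f (first T) (T \<inter> D (first T))" for T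
  define A where "A n = {T \<in> closed_hyperspace Z. T \<inter> D n \<noteq> {} \<and> (\<forall>k<n. T \<inter> D k = {})}" for n
  have ex: "\<exists>n. T \<inter> D n \<noteq> {}" if "T \<in> closed_hyperspace Z" for T
  proof -
    have "T \<noteq> {}" "T \<subseteq> (\<Union>n. D n)"
      using that cover by (auto simp: closed_hyperspace_def dest: closedin_subset)
    then show ?thesis by blast
  qed
  have inA: "T \<in> A (first T)" if "T \<in> closed_hyperspace Z" for T
    using that LeastI_ex[OF ex[OF that]] not_less_Least unfolding A_def first_def by auto
  have first: "first T = n" if "T \<in> A n" for T n
    using that unfolding A_def first_def
    by (intro Least_equality) (auto simp flip: not_less)
  have mem: "T \<inter> D n \<in> closed_hyperspace (subtopology Z (D n))" if "T \<in> A n" for T n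
    using that unfolding A_def closed_hyperspace_def
    by (auto simp: closedin_subtopology)
  have openA: "openin (vietoris_topology Z) (A n)" for n
  proof -
    have "A n = {T \<in> closed_hyperspace Z. T \<inter> D n \<noteq> {}} \<inter>
        {T \<in> closed_hyperspace Z. T \<subseteq> topspace Z - (\<Union>k<n. D k)}"
      unfolding A_def by (auto simp: closed_hyperspace_def dest: closedin_subset)
    moreover have "openin (vietoris_topology Z) \<dots>"
      using clopen
      by (intro openin_Int openin_vietoris_meets openin_vietoris_subset openin_diff closedin_Union) auto
    ultimately show ?thesis by simp
  qed
  have top: "topspace (subtopology (vietoris_topology Z) (A n)) = A n" for n
  proof -
    have "A n \<subseteq> closed_hyperspace Z"
      unfolding A_def by (rule Collect_subset)
    then show ?thesis by (simp add: Int_absorb1)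
  qed
  have cont: "continuous_map (subtopology (vietoris_topology Z) (A n))
      (vietoris_topology (subtopology Z (D n))) (\<lambda>T. T \<inter> D n)" for n
  proof (rule continuous_map_into_vietoris)
    fix x assume "x \<in> topspace (subtopology (vietoris_topology Z) (A n))"
    then show "x \<inter> D n \<in> closed_hyperspace (subtopology Z (D n))"
      unfolding top by (rule mem)
  next
    fix U assume "openin (subtopology Z (D n)) U"
    then have U: "openin Z U" "U \<subseteq> D n"
      using clopen(1)[of n] by (auto simp: openin_open_subtopology)
    \<comment> \<open>As \<open>D n\<close> is closed, the condition
      \<open>T \<inter> D n \<subseteq> U\<close> becomes containment of \<open>T\<close> in an open
      set of \<open>Z\<close>.\<close>
    have o: "openin Z (U \<union> (topspace Z - D n))"
      using U clopen(2)[of n] by auto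
    have "{T \<in> A n. T \<inter> D n \<subseteq> U} = {T \<in> closed_hyperspace Z. T \<subseteq> U \<union> (topspace Z - D n)} \<inter> A n"
      unfolding A_def closed_hyperspace_def by (auto dest: closedin_subset)
    then show "openin (subtopology (vietoris_topology Z) (A n))
        {T \<in> topspace (subtopology (vietoris_topology Z) (A n)). T \<inter> D n \<subseteq> U}"
      unfolding top openin_subtopology using openin_vietoris_subset[OF o] by blast
    have "{T \<in> A n. T \<inter> D n \<inter> U \<noteq> {}} = {T \<in> closed_hyperspace Z. T \<inter> U \<noteq> {}} \<inter> A n"
      unfolding A_def using U by auto
    then show "openin (subtopology (vietoris_topology Z) (A n))
        {T \<in> topspace (subtopology (vietoris_topology Z) (A n)). T \<inter> D n \<inter> U \<noteq> {}}"
      unfolding top openin_subtopology using openin_vietoris_meets[OF U(1)] by blast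
  qed
  have h_in: "h T \<in> T" if "T \<in> closed_hyperspace Z" for T
    using f(2)[OF mem[OF inA[OF that]]] unfolding h_def by auto
  have "continuous_map (vietoris_topology Z) Z h"
    unfolding continuous_map_def
  proof (intro conjI allI impI)
    show "h \<in> topspace (vietoris_topology Z) \<rightarrow> topspace Z"
    proof (rule Pi_I)
      fix T assume "T \<in> topspace (vietoris_topology Z)"
      then have "T \<in> closed_hyperspace Z" by simp
      moreover from this have "T \<subseteq> topspace Z"
        unfolding closed_hyperspace_def by (auto dest: closedin_subset)
      ultimately show "h T \<in> topspace Z"
        using h_in by blast
    qed
    fix O' assume O': "openin Z O'"
    have "openin (vietoris_topology Z) {T \<in> A n. f n (T \<inter> D n) \<in> O'}" for n
    proof -
      have "continuous_map (subtopology (vietoris_topology Z) (A n)) (subtopology Z (D n)) (\<lambda>T. f n (T \<inter> D n))"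
        using continuous_map_compose[OF cont[of n] f(1)[of n]] unfolding o_def .
      then have "continuous_map (subtopology (vietoris_topology Z) (A n)) Z (\<lambda>T. f n (T \<inter> D n))"
        by (rule continuous_map_into_fulltopology)
      then have "openin (subtopology (vietoris_topology Z) (A n))
          {T \<in> topspace (subtopology (vietoris_topology Z) (A n)). f n (T \<inter> D n) \<in> O'}"
        using O' by (rule openin_continuous_map_preimage)
      then show ?thesis
        unfolding top using openA[of n] by (rule openin_trans_full)
    qed
    then have "openin (vietoris_topology Z) (\<Union>n. {T \<in> A n. f n (T \<inter> D n) \<in> O'})"
      by (intro openin_Union) blast
    moreover have "{T \<in> topspace (vietoris_topology Z). h T \<in> O'} = (\<Union>n. {T \<in> A n. f n (T \<inter> D n) \<in> O'})"
    proof (intro equalityI subsetI)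
      fix T assume "T \<in> {T \<in> topspace (vietoris_topology Z). h T \<in> O'}"
      then show "T \<in> (\<Union>n. {T \<in> A n. f n (T \<inter> D n) \<in> O'})"
        using inA unfolding h_def by (intro UN_I[of "first T"]) simp_all
    next
      fix T assume "T \<in> (\<Union>n. {T \<in> A n. f n (T \<inter> D n) \<in> O'})"
      then obtain n where n: "T \<in> A n" "f n (T \<inter> D n) \<in> O'"
        by blast
      then show "T \<in> {T \<in> topspace (vietoris_topology Z). h T \<in> O'}"
        using first[OF n(1)] by (simp add: h_def A_def)
    qed
    ultimately show "openin (vietoris_topology Z) {T \<in> topspace (vietoris_topology Z). h T \<in> O'}"
      by (simp only:)
  qed
  then show ?thesis
    unfolding has_continuous_selection_def using h_in by blast
qed

section \<open>Finite sets in the hyperspace\<close>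

lemma continuous_map_insert_vietoris:
  assumes "Hausdorff_space Z" "finite K" "K \<subseteq> topspace Z"
  shows "continuous_map Z (vietoris_topology Z) (\<lambda>y. insert y K)"
proof (rule continuous_map_into_vietoris)
  fix x assume "x \<in> topspace Z"
  then show "insert x K \<in> closed_hyperspace Z"
    using assms by (simp add: closed_hyperspace_def closedin_Hausdorff_finite)
next
  fix U assume U: "openin Z U"
  then have "{x \<in> topspace Z. insert x K \<subseteq> U} = (if K \<subseteq> U then U else {})"
    using openin_subset by auto
  then show "openin Z {x \<in> topspace Z. insert x K \<subseteq> U}"
    using U by simp
  have "{x \<in> topspace Z. insert x K \<inter> U \<noteq> {}} = (if K \<inter> U = {} then U else topspace Z)"
    using openin_subset[OF U] by auto
  then show "openin Z {x \<in> topspace Z. insert x K \<inter> U \<noteq> {}}"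
    using U by simp
qed

text \<open>For a basic neighbourhood of the whole space, one point chosen from each member of its
  family is enough: every closed set containing these points lies in the neighbourhood. In a
  Hausdorff space, finite sets thereby approximate the whole space.\<close>

lemma vietoris_neighbourhood_topspace:
  assumes "openin (vietoris_topology Z) \<U>" "topspace Z \<in> \<U>"
  shows "\<exists>F. finite F \<and> F \<subseteq> topspace Z \<and> (\<forall>T \<in> closed_hyperspace Z. F \<subseteq> T \<longrightarrow> T \<in> \<U>)"
proof -
  have "generate_topology_on {vietoris_set Z \<V> | \<V>. finite \<V> \<and> (\<forall>V \<in> \<V>. openin Z V)} \<U>"
    using assms(1) unfolding vietoris_topology_def by (rule openin_topology_generated_by)
  then show ?thesis
    using assms(2)
  proof induction
    case Empty
    then show ?case by simp
  next
    case (Int a b)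
    then obtain F G where "finite F" "F \<subseteq> topspace Z" "\<forall>T \<in> closed_hyperspace Z. F \<subseteq> T \<longrightarrow> T \<in> a"
      and "finite G" "G \<subseteq> topspace Z" "\<forall>T \<in> closed_hyperspace Z. G \<subseteq> T \<longrightarrow> T \<in> b"
      by auto
    then show ?case
      by (intro exI[of _ "F \<union> G"]) auto
  next
    case (UN K)
    then obtain k where "k \<in> K" "topspace Z \<in> k"
      by blast
    from UN.IH[OF this] obtain F where "finite F" "F \<subseteq> topspace Z"
      and F: "\<forall>T \<in> closed_hyperspace Z. F \<subseteq> T \<longrightarrow> T \<in> k"
      by blast
    then show ?case
      using \<open>k \<in> K\<close> by (intro exI[of _ F]) auto
  next
    case (Basis s)
    from Basis.hyps obtain \<V> where s: "s = vietoris_set Z \<V>" and \<V>: "finite \<V>"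
      by auto
    have cov: "topspace Z \<subseteq> \<Union>\<V>" and ne: "\<And>V. V \<in> \<V> \<Longrightarrow> \<exists>v. v \<in> topspace Z \<inter> V"
      using Basis.prems unfolding s vietoris_set_def by auto
    from ne obtain c where c: "\<And>V. V \<in> \<V> \<Longrightarrow> c V \<in> topspace Z \<inter> V"
      by metis
    have "T \<in> s" if T: "T \<in> closed_hyperspace Z" "c ` \<V> \<subseteq> T" for T
    proof -
      have "T \<subseteq> \<Union>\<V>"
        using T(1) cov closedin_subset unfolding closed_hyperspace_def by blast
      moreover have "T \<inter> V \<noteq> {}" if "V \<in> \<V>" for V
        using T(2) c[OF that] that by blast
      ultimately show ?thesis
        using T(1) unfolding s vietoris_set_def by blast
    qed
    then show ?case
      using \<V> c by (intro exI[of _ "c ` \<V>"]) auto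
  qed
qed


section \<open>The order given by a selection\<close>

text \<open>These are the properties of the relation \<open>x \<noteq> y \<and> f {x, y} = x\<close>
  of a selection \<open>f\<close> on which the order arguments rest. Transitivity is derived in
  \<open>trans\<close> when the space is connected.\<close>

locale selection_order =
  fixes X :: "'a topology" and R :: "'a \<Rightarrow> 'a \<Rightarrow> bool"
  assumes asym: "\<lbrakk>x \<in> topspace X; y \<in> topspace X; R x y\<rbrakk> \<Longrightarrow> \<not> R y x"
    and total: "\<lbrakk>x \<in> topspace X; y \<in> topspace X; x \<noteq> y\<rbrakk> \<Longrightarrow> R x y \<or> R y x"
    and open_above: "x \<in> topspace X \<Longrightarrow> openin X {y \<in> topspace X. R x y}"
    and open_below: "x \<in> topspace X \<Longrightarrow> openin X {y \<in> topspace X. R y x}"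
begin

lemma irrefl: "x \<in> topspace X \<Longrightarrow> \<not> R x x"
  using asym by blast

lemma dual: "selection_order X (\<lambda>x y. R y x)"
  using asym total open_above open_below by unfold_locales auto

lemma subspace: "selection_order (subtopology X S) R"
proof
  fix x assume x: "x \<in> topspace (subtopology X S)"
  have "{y \<in> topspace (subtopology X S). R x y} = {y \<in> topspace X. R x y} \<inter> S"
    "{y \<in> topspace (subtopology X S). R y x} = {y \<in> topspace X. R y x} \<inter> S"
    by auto
  then show "openin (subtopology X S) {y \<in> topspace (subtopology X S). R x y}"
    "openin (subtopology X S) {y \<in> topspace (subtopology X S). R y x}"
    using open_above[of x] open_below[of x] x by (auto simp: openin_subtopology)
qed (use asym total in auto)

lemma closed_atleast:
  assumes "x \<in> topspace X"
  shows "closedin X {y \<in> topspace X. y = x \<or> R x y}"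
proof -
  have "topspace X - {y \<in> topspace X. y = x \<or> R x y} = {y \<in> topspace X. R y x}"
    using assms asym total irrefl by blast
  then show ?thesis
    using open_below[OF assms] by (auto simp: closedin_def)
qed

lemma closed_atmost:
  assumes "x \<in> topspace X"
  shows "closedin X {y \<in> topspace X. y = x \<or> R y x}"
  using selection_order.closed_atleast[OF dual assms] .

section \<open>Rays and intervals of a connected space\<close>

text \<open>If the closed ray splits into closed sets \<open>E1\<close> and \<open>E2\<close> with
  \<open>x \<in> E1\<close>, then adding the opposite closed ray to \<open>E1\<close> splits the
  whole space.\<close>

lemma connected_atleast:
  assumes conn: "connected_space X" and x: "x \<in> topspace X"
  shows "connectedin X {y \<in> topspace X. y = x \<or> R x y}" (is "connectedin X ?C")
proof -
  have "False" if E: "closedin (subtopology X ?C) E1" "closedin (subtopology X ?C) E2"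
      "E1 \<union> E2 = ?C" "E1 \<inter> E2 = {}" "E2 \<noteq> {}" "x \<in> E1" for E1 E2
  proof -
    have "closedin X E1" "closedin X E2"
      using E(1,2) closedin_trans_full closed_atleast[OF x] by metis+
    moreover have "(E1 \<union> {y \<in> topspace X. y = x \<or> R y x}) \<union> E2 = topspace X"
      using E(3) total[OF x] by auto
    moreover have "(E1 \<union> {y \<in> topspace X. y = x \<or> R y x}) \<inter> E2 = {}"
      using E(3,4,6) asym x by fastforce
    moreover have "E1 \<union> {y \<in> topspace X. y = x \<or> R y x} \<noteq> {}"
      using E(6) by blast
    moreover have "closedin X (E1 \<union> {y \<in> topspace X. y = x \<or> R y x})"
      using \<open>closedin X E1\<close> closed_atmost[OF x] by (rule closedin_Un)
    ultimately have "\<exists>A B. closedin X A \<and> closedin X B \<and> A \<union> B = topspace X \<and> A \<inter> B = {} \<and> A \<noteq> {} \<and> B \<noteq> {}"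
      using E(5) by (intro exI conjI)
    then show False
      using conn unfolding connected_space_closedin_eq by (rule notE[rotated])
  qed
  note * = this
  show ?thesis
    unfolding connectedin_def connected_space_closedin_eq
  proof (intro conjI notI)
    assume "\<exists>E1 E2. closedin (subtopology X ?C) E1 \<and> closedin (subtopology X ?C) E2 \<and>
       E1 \<union> E2 = topspace (subtopology X ?C) \<and> E1 \<inter> E2 = {} \<and> E1 \<noteq> {} \<and> E2 \<noteq> {}"
    then obtain E1 E2 where E: "closedin (subtopology X ?C) E1" "closedin (subtopology X ?C) E2"
      "E1 \<union> E2 = topspace (subtopology X ?C)" "E1 \<inter> E2 = {}" "E1 \<noteq> {}" "E2 \<noteq> {}"
      by (elim exE conjE)
    moreover have top: "topspace (subtopology X ?C) = ?C"
      unfolding topspace_subtopology by blast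
    ultimately have "E1 \<union> E2 = ?C"
      by simp
    have "x \<in> ?C" using x by simp
    with \<open>E1 \<union> E2 = ?C\<close> consider "x \<in> E1" | "x \<in> E2" by blast
    then show False
    proof cases
      case 1
      then show ?thesis using *[OF E(1,2) \<open>E1 \<union> E2 = ?C\<close> E(4,6)] by blast
    next
      case 2
      have "E2 \<union> E1 = ?C" "E2 \<inter> E1 = {}"
        using \<open>E1 \<union> E2 = ?C\<close> E(4) by (simp_all add: Un_commute Int_commute)
      then show ?thesis using 2 *[OF E(2,1) _ _ E(5)] by blast
    qed
  qed auto
qed

text \<open>The closed ray above \<open>y\<close> is connected and avoids \<open>x\<close>, so it
  cannot meet both open rays at \<open>x\<close>. It meets the upper one in \<open>y\<close>, hence
  \<open>z\<close> lies there too.\<close>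

lemma trans:
  assumes conn: "connected_space X" and "x \<in> topspace X" "y \<in> topspace X" "z \<in> topspace X"
    and "R x y" "R y z"
  shows "R x z"
proof (rule ccontr)
  assume "\<not> R x z"
  moreover have "x \<noteq> z" using assms asym by blast
  ultimately have "R z x" using assms total by blast
  let ?C = "{w \<in> topspace X. w = y \<or> R y w}"
  have "?C \<subseteq> {w \<in> topspace X. R x w} \<union> {w \<in> topspace X. R w x}"
    using assms(2,3,5) total asym by auto
  moreover have "{w \<in> topspace X. R x w} \<inter> {w \<in> topspace X. R w x} \<inter> ?C = {}"
    using asym assms(2) by blast
  moreover have "y \<in> {w \<in> topspace X. R x w} \<inter> ?C" "z \<in> {w \<in> topspace X. R w x} \<inter> ?C"
    using assms \<open>R z x\<close> by auto
  ultimately show False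
    using connected_atleast[OF conn \<open>y \<in> topspace X\<close>] open_above[OF assms(2)] open_below[OF assms(2)]
    unfolding connectedin by blast
qed

text \<open>Any two points of the open ray lie in the closed ray above the smaller one, which is
  connected and stays inside the open ray by transitivity.\<close>

lemma connected_above:
  assumes conn: "connected_space X" and x: "x \<in> topspace X"
  shows "connectedin X {y \<in> topspace X. R x y}"
proof -
  have "\<exists>S. connectedin (subtopology X {w \<in> topspace X. R x w}) S \<and> y \<in> S \<and> z \<in> S"
    if "y \<in> {w \<in> topspace X. R x w}" "z \<in> {w \<in> topspace X. R x w}" "y = z \<or> R y z" for y z
  proof -
    have "{w \<in> topspace X. w = y \<or> R y w} \<subseteq> {w \<in> topspace X. R x w}"
      using that trans[OF conn x] by blast
    then show ?thesis
      using that connected_atleast[OF conn, of y]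
      by (intro exI[of _ "{w \<in> topspace X. w = y \<or> R y w}"]) (auto simp: connectedin_subtopology)
  qed
  then have "connected_space (subtopology X {w \<in> topspace X. R x w})"
    unfolding connected_space_subconnected using total
    by (metis (no_types, lifting) Int_iff mem_Collect_eq topspace_subtopology)
  then show ?thesis
    by (auto simp: connectedin_def)
qed

lemma connected_below:
  assumes "connected_space X" "x \<in> topspace X"
  shows "connectedin X {y \<in> topspace X. R y x}"
  using selection_order.connected_above[OF dual assms] .

lemma connected_between:
  assumes conn: "connected_space X" and x: "x \<in> topspace X" and y: "y \<in> topspace X" and "R x y"
  shows "connectedin X {z \<in> topspace X. R x z \<and> R z y}"
proof -
  let ?S = "{z \<in> topspace X. R x z}"
  have top: "topspace (subtopology X ?S) = ?S"
    by auto
  interpret S: selection_order "subtopology X ?S" R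
    by (rule subspace)
  have "connectedin (subtopology X ?S) {z \<in> topspace (subtopology X ?S). R z y}"
    using S.connected_below[of y] connected_above[OF conn x] assms
    unfolding top by (auto simp: connectedin_def)
  then have "connectedin X {z \<in> ?S. R z y}"
    unfolding top connectedin_subtopology by simp
  then show ?thesis
    by (simp add: conj_assoc)
qed

text \<open>With nothing in between, the ray below \<open>y\<close> and the ray above
  \<open>x\<close> would be disjoint, and by transitivity they cover the space.\<close>

lemma between_nonempty:
  assumes conn: "connected_space X" and x: "x \<in> topspace X" and y: "y \<in> topspace X" and "R x y"
  shows "\<exists>z \<in> topspace X. R x z \<and> R z y"
proof (rule ccontr)
  assume "\<not> ?thesis"
  then have "{z \<in> topspace X. R z y} \<inter> {z \<in> topspace X. R x z} = {}"
    by blast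
  moreover have "{z \<in> topspace X. R z y} \<union> {z \<in> topspace X. R x z} = topspace X"
    using total[OF y] trans[OF conn x y] \<open>R x y\<close> by auto
  moreover have "x \<in> {z \<in> topspace X. R z y}" "y \<in> {z \<in> topspace X. R x z}"
    using assms by auto
  ultimately show False
    using conn open_below[OF y] open_above[OF x] unfolding connected_space_eq by blast
qed

section \<open>Cut points\<close>

lemma cut_of_between:
  assumes "x \<in> topspace X" "y \<in> topspace X" "z \<in> topspace X" "R x y" "R y z"
  shows "\<not> connectedin X (topspace X - {y})"
proof
  assume "connectedin X (topspace X - {y})"
  moreover have "topspace X - {y} \<subseteq> {w \<in> topspace X. R w y} \<union> {w \<in> topspace X. R y w}"
    using total assms by blast
  moreover have "{w \<in> topspace X. R w y} \<inter> {w \<in> topspace X. R y w} \<inter> (topspace X - {y}) = {}"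
    using asym assms by blast
  moreover have "x \<in> {w \<in> topspace X. R w y} \<inter> (topspace X - {y})"
    "z \<in> {w \<in> topspace X. R y w} \<inter> (topspace X - {y})"
    using assms irrefl by auto
  ultimately show False
    using open_above[OF \<open>y \<in> topspace X\<close>] open_below[OF \<open>y \<in> topspace X\<close>]
    unfolding connectedin by blast
qed

text \<open>Among three points, even if they form a cycle, there is always a chain
  \<open>R u v\<close>, \<open>R v w\<close>; its middle point is a cut point.\<close>

lemma cut_point_among_three:
  assumes "x \<in> topspace X" "y \<in> topspace X" "z \<in> topspace X" "x \<noteq> y" "y \<noteq> z" "x \<noteq> z"
  shows "\<exists>w \<in> {x, y, z}. \<not> connectedin X (topspace X - {w})"
proof -
  have "R x y \<or> R y x" "R y z \<or> R z y" "R x z \<or> R z x"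
    using assms total by simp_all
  then have "\<exists>u \<in> {x, y, z}. \<exists>v \<in> {x, y, z}. \<exists>w \<in> {x, y, z}. R u v \<and> R v w"
    by blast
  then show ?thesis
    using cut_of_between assms(1-3) by blast
qed

lemma finite_has_least:
  assumes conn: "connected_space X" and "finite G" "G \<noteq> {}" "G \<subseteq> topspace X"
  shows "\<exists>m \<in> G. \<forall>x \<in> G. x = m \<or> R m x"
  using assms(2-)
proof (induction rule: finite_ne_induct)
  case (insert y F)
  then obtain m where m: "m \<in> F" "\<forall>x \<in> F. x = m \<or> R m x"
    by auto
  have y: "y \<in> topspace X" and mt: "m \<in> topspace X" and F: "F \<subseteq> topspace X" and "y \<noteq> m"
    using insert m by auto
  from total[OF y mt \<open>y \<noteq> m\<close>] show ?case
  proof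
    assume "R y m"
    have "R y x" if x: "x \<in> F" for x
    proof (cases "x = m")
      case False
      then show ?thesis
        using trans[OF conn y mt _ \<open>R y m\<close>] m(2) F x by auto
    qed (use \<open>R y m\<close> in simp)
    then show ?thesis by blast
  qed (use m in blast)
qed simp

section \<open>Connected sets joining points that no clopen set separates\<close>

text \<open>A splitting of the interval into closed sets \<open>E1\<close> with
  \<open>a \<in> E1\<close> and \<open>E2\<close> yields a clopen set of \<open>X\<close> containing
  \<open>a\<close> but not \<open>b\<close>. If \<open>b \<in> E2\<close>, enlarge \<open>E1\<close>
  by the points below both ends. If both ends lie in \<open>E1\<close>, cut off the ray below a
  point of \<open>E2\<close>.\<close>

lemma connected_between_unseparated:
  assumes a: "a \<in> topspace X" and b: "b \<in> topspace X" and "R a b"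
    and unsep: "\<And>C. \<lbrakk>openin X C; closedin X C; a \<in> C\<rbrakk> \<Longrightarrow> b \<in> C"
  shows "connectedin X {z \<in> topspace X. (z = a \<or> R a z) \<and> (z = b \<or> R z b)}" (is "connectedin X ?J")
proof -
  have J_eq: "?J = {z \<in> topspace X. z = a \<or> R a z} \<inter> {z \<in> topspace X. z = b \<or> R z b}"
    by blast
  have closedJ: "closedin X ?J"
    unfolding J_eq using closed_atleast[OF a] closed_atmost[OF b] by (rule closedin_Int)
  have aJ: "a \<in> ?J" and bJ: "b \<in> ?J"
    using a b \<open>R a b\<close> by auto
  have "a \<noteq> b"
    using irrefl a \<open>R a b\<close> by blast
  have False if E: "closedin X E1" "closedin X E2" "E1 \<union> E2 = ?J" "E1 \<inter> E2 = {}" "a \<in> E1" "E2 \<noteq> {}" for E1 E2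
  proof (cases "b \<in> E1")
    case False
    \<comment> \<open>Without transitivity, points below both ends have to be told apart from those below \<open>a\<close> and above \<open>b\<close>.\<close>
    let ?C = "E1 \<union> ({z \<in> topspace X. R z a} \<inter> {z \<in> topspace X. R z b})"
    let ?D = "E2 \<union> {z \<in> topspace X. z = b \<or> R b z}"
    have "b \<in> E2"
      using bJ False E(3) by blast
    \<comment> \<open>The intersection form shows that \<open>?C\<close> is closed; its complement
      turns out to be \<open>?D\<close>, which is closed as well.\<close>
    have C1: "?C = (E1 \<union> {z \<in> topspace X. z = a \<or> R z a}) \<inter> {z \<in> topspace X. z = b \<or> R z b}"
      using E(3,5) \<open>R a b\<close> False \<open>b \<in> E2\<close> bJ asym[OF a b] by blast
    have closedC: "closedin X ?C"
      unfolding C1 using E(1) closed_atmost[OF a] closed_atmost[OF b]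
      by (intro closedin_Int closedin_Un)
    have "topspace X - ?C = E2 \<union> {z \<in> topspace X. z = b \<or> R b z}"
    proof (intro equalityI subsetI)
      fix z assume z: "z \<in> topspace X - ?C"
      then have zt: "z \<in> topspace X" by blast
      show "z \<in> ?D"
      proof (rule ccontr)
        assume "z \<notin> ?D"
        then have "R z b" "z \<notin> E2"
          using total[OF zt b] zt by auto
        then have "R z a" "z \<notin> ?J"
          using z E(3) total[OF zt a] zt by auto
        then show False
          using z zt \<open>R z b\<close> by blast
      qed
    next
      fix z assume z: "z \<in> ?D"
      have zt: "z \<in> topspace X"
        using z E(3) by blast
      have "z \<notin> E1"
      proof
        assume "z \<in> E1"
        then have "z \<noteq> b" "z \<notin> E2" "z \<in> ?J"
          using E(3,4) False by blast+
        then show False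
          using z asym[OF zt b] by simp
      qed
      moreover have "\<not> (R z a \<and> R z b)"
      proof (cases "z \<in> E2")
        case True
        then have "R a z"
          using E(3-5) by blast
        then show ?thesis
          using asym[OF a zt] by simp
      next
        case False
        then have "z = b \<or> R b z"
          using z by blast
        then show ?thesis
          using asym[OF b zt] irrefl[OF b] by auto
      qed
      ultimately show "z \<in> topspace X - ?C"
        using zt by blast
    qed
    then have "openin X ?C"
      using closedC E(2) closed_atleast[OF b] by (metis (no_types, lifting) closedin_Un closedin_subset openin_closedin)
    then show False
      using unsep[OF _ closedC] E(5) False irrefl[OF b] by blast
  next
    case True
    then obtain z where z: "z \<in> E2"
      using E(6) by blast
    have E2: "E2 \<subseteq> ?J - {a, b}"
      using E True by blast
    then have zz: "z \<in> topspace X" "R a z" "R z b"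
      using z by auto
    \<comment> \<open>As \<open>E2\<close> avoids both ends, it is the open interval minus the
      closed set \<open>E1\<close>.\<close>
    have "E2 = ({y \<in> topspace X. R a y} \<inter> {y \<in> topspace X. R y b}) - E1"
      using E2 E(3,4) by blast
    moreover have "openin X \<dots>"
      using open_above[OF a] open_below[OF b] E(1) by (intro openin_diff openin_Int)
    ultimately have "openin X E2" by simp
    \<comment> \<open>\<open>E2\<close> is clopen in \<open>X\<close>, so removing it from the ray below \<open>z\<close> makes the ray clopen.\<close>
    let ?C = "{y \<in> topspace X. R y z} - E2"
    have "openin X ?C"
      using open_below[OF zz(1)] E(2) by (rule openin_diff)
    moreover have "?C = {y \<in> topspace X. y = z \<or> R y z} - E2"
      using z by blast
    then have "closedin X ?C"
      using closed_atmost[OF zz(1)] \<open>openin X E2\<close> by (metis closedin_diff)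
    moreover have "a \<in> ?C"
      using zz a E(4,5) by blast
    ultimately have "b \<in> ?C"
      by (rule unsep)
    then show False
      using asym[OF b zz(1)] zz(3) by blast
  qed
  note * = this
  show ?thesis
    unfolding connectedin_def connected_space_closedin_eq
  proof (intro conjI notI)
    assume "\<exists>E1 E2. closedin (subtopology X ?J) E1 \<and> closedin (subtopology X ?J) E2 \<and>
       E1 \<union> E2 = topspace (subtopology X ?J) \<and> E1 \<inter> E2 = {} \<and> E1 \<noteq> {} \<and> E2 \<noteq> {}"
    then obtain E1 E2 where E: "closedin (subtopology X ?J) E1" "closedin (subtopology X ?J) E2"
      "E1 \<union> E2 = topspace (subtopology X ?J)" "E1 \<inter> E2 = {}" "E1 \<noteq> {}" "E2 \<noteq> {}"
      by (elim exE conjE)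
    moreover have top: "topspace (subtopology X ?J) = ?J"
      unfolding topspace_subtopology by blast
    ultimately have EJ: "E1 \<union> E2 = ?J" "E2 \<union> E1 = ?J" "E2 \<inter> E1 = {}"
      by (simp_all add: Un_commute Int_commute)
    have cl: "closedin X E1" "closedin X E2"
      using E(1,2) closedJ closedin_trans_full by blast+
    from aJ EJ(1) consider "a \<in> E1" | "a \<in> E2" by blast
    then show False
      using *[OF cl EJ(1) E(4) _ E(6)] *[OF cl(2,1) EJ(2,3) _ E(5)] by cases
  qed blast
qed

text \<open>Taking complements makes separation by clopen sets symmetric in \<open>a\<close> and
  \<open>b\<close>, so the interval can be formed in whichever direction \<open>R\<close> relates
  them.\<close>

lemma unseparated_in_connected:
  assumes a: "a \<in> topspace X" and b: "b \<in> topspace X" and "a \<noteq> b"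
    and unsep: "\<And>C. \<lbrakk>openin X C; closedin X C; a \<in> C\<rbrakk> \<Longrightarrow> b \<in> C"
  shows "\<exists>J. closedin X J \<and> connectedin X J \<and> a \<in> J \<and> b \<in> J"
proof -
  have closed: "closedin X {z \<in> topspace X. (z = c \<or> R c z) \<and> (z = d \<or> R z d)}"
    if "c \<in> topspace X" "d \<in> topspace X" for c d
  proof -
    have "{z \<in> topspace X. (z = c \<or> R c z) \<and> (z = d \<or> R z d)} =
        {z \<in> topspace X. z = c \<or> R c z} \<inter> {z \<in> topspace X. z = d \<or> R z d}"
      by blast
    then show ?thesis
      using closedin_Int[OF closed_atleast[OF that(1)] closed_atmost[OF that(2)]] by simp
  qed
  from total[OF a b \<open>a \<noteq> b\<close>] show ?thesis
  proof
    assume "R a b"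
    then show ?thesis
      using connected_between_unseparated[OF a b \<open>R a b\<close> unsep] closed[OF a b] a b
      by (intro exI[of _ "{z \<in> topspace X. (z = a \<or> R a z) \<and> (z = b \<or> R z b)}"]) simp
  next
    assume "R b a"
    have sym: "a \<in> C" if "openin X C" "closedin X C" "b \<in> C" for C
      using unsep[of "topspace X - C"] that a by auto
    then show ?thesis
      using connected_between_unseparated[OF b a \<open>R b a\<close> sym] closed[OF b a] a b \<open>R b a\<close>
      by (intro exI[of _ "{z \<in> topspace X. (z = b \<or> R b z) \<and> (z = a \<or> R z a)}"]) simp
  qed
qed

end

section \<open>Selections on connected spaces\<close>

text \<open>When \<open>y\<close> moves slightly to \<open>w\<close>, the selected point stays in a
  neighbourhood \<open>N\<close> of \<open>m\<close>. Removing the other points of \<open>K\<close>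
  from \<open>N\<close>, and keeping \<open>w\<close> outside \<open>N\<close>, leaves
  \<open>m\<close> as the only possible value.\<close>

lemma openin_selection_eq:
  assumes haus: "Hausdorff_space Z" and cont: "continuous_map (vietoris_topology Z) Z f"
    and sel: "\<And>T. T \<in> closed_hyperspace Z \<Longrightarrow> f T \<in> T"
    and K: "finite K" "K \<subseteq> topspace Z" and "m \<in> K"
  shows "openin Z {y \<in> topspace Z. y \<noteq> m \<and> f (insert y K) = m}" (is "openin Z ?S")
proof -
  have cont': "continuous_map Z Z (\<lambda>y. f (insert y K))"
    using continuous_map_compose[OF continuous_map_insert_vietoris[OF haus K] cont] unfolding o_def .
  have "\<exists>N. openin Z N \<and> y \<in> N \<and> N \<subseteq> ?S" if y: "y \<in> ?S" for y
  proof -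
    have "m \<in> topspace Z" "y \<in> topspace Z" "m \<noteq> y"
      using y \<open>m \<in> K\<close> K by auto
    then obtain N N' where N: "openin Z N" "openin Z N'" "m \<in> N" "y \<in> N'" "disjnt N N'"
      using haus unfolding Hausdorff_space_def by blast
    define V where "V = {w \<in> topspace Z. f (insert w K) \<in> N - (K - {m})}"
    have "closedin Z (K - {m})"
      using closedin_Hausdorff_finite[OF haus, of "K - {m}"] K by auto
    then have "openin Z (N - (K - {m}))"
      using N(1) by (rule openin_diff[rotated])
    then have "openin Z V"
      unfolding V_def using cont' openin_continuous_map_preimage by blast
    moreover have "y \<in> V"
      unfolding V_def using y N(3) by auto
    moreover have "N' \<inter> V \<subseteq> ?S"
    proof
      fix w assume w: "w \<in> N' \<inter> V"
      then have wt: "w \<in> topspace Z" and fw: "f (insert w K) \<in> N - (K - {m})"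
        unfolding V_def by auto
      have "insert w K \<in> closed_hyperspace Z"
        unfolding closed_hyperspace_def using closedin_Hausdorff_finite[OF haus, of "insert w K"] K wt by auto
      then have "f (insert w K) \<in> insert w K"
        by (rule sel)
      moreover have "w \<notin> N"
        using w N(5) by (auto simp: disjnt_iff)
      ultimately show "w \<in> ?S"
        using fw wt N(3) by auto
    qed
    ultimately show ?thesis
      using N(2,4) by (intro exI[of _ "N' \<inter> V"]) auto
  qed
  then show ?thesis
    by (subst openin_subopen) blast
qed

text \<open>The ray above \<open>x\<close> is open by \<open>openin_selection_eq\<close> with
  \<open>K = {x}\<close>; the ray below \<open>x\<close> is the preimage of the complement of
  \<open>x\<close> under the map sending \<open>y\<close> to \<open>f {y, x}\<close>.\<close>

lemma selection_order_of_selection: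
  assumes haus: "Hausdorff_space Z" and cont: "continuous_map (vietoris_topology Z) Z f"
    and sel: "\<And>T. T \<in> closed_hyperspace Z \<Longrightarrow> f T \<in> T"
  shows "selection_order Z (\<lambda>x y. x \<noteq> y \<and> f {x, y} = x)"
proof
  have mem: "f {x, y} \<in> {x, y}" if "x \<in> topspace Z" "y \<in> topspace Z" for x y
  proof (rule sel)
    show "{x, y} \<in> closed_hyperspace Z"
      unfolding closed_hyperspace_def using closedin_Hausdorff_finite[OF haus, of "{x, y}"] that by simp
  qed
  fix x assume x: "x \<in> topspace Z"
  have "{y \<in> topspace Z. x \<noteq> y \<and> f {x, y} = x} = {y \<in> topspace Z. y \<noteq> x \<and> f {y, x} = x}"
    by (auto simp: insert_commute)
  then show "openin Z {y \<in> topspace Z. x \<noteq> y \<and> f {x, y} = x}"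
    using openin_selection_eq[OF haus cont sel, of "{x}" x] x by simp
  have "continuous_map Z Z (\<lambda>y. f {y, x})"
    using continuous_map_compose[OF continuous_map_insert_vietoris[OF haus, of "{x}"] cont] x
    unfolding o_def by simp
  moreover have "openin Z (topspace Z - {x})"
    using closedin_Hausdorff_singleton[OF haus x] by blast
  ultimately have "openin Z {y \<in> topspace Z. f {y, x} \<in> topspace Z - {x}}"
    by (rule openin_continuous_map_preimage)
  moreover have "{y \<in> topspace Z. f {y, x} \<in> topspace Z - {x}} = {y \<in> topspace Z. y \<noteq> x \<and> f {y, x} = y}"
    using mem[OF _ x] x by fastforce
  ultimately show "openin Z {y \<in> topspace Z. y \<noteq> x \<and> f {y, x} = y}"
    by simp
next
  fix x y assume "x \<in> topspace Z" "y \<in> topspace Z" "x \<noteq> y \<and> f {x, y} = x"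
  then show "\<not> (y \<noteq> x \<and> f {y, x} = y)"
    by (simp add: insert_commute)
next
  fix x y assume xy: "x \<in> topspace Z" "y \<in> topspace Z" "x \<noteq> y"
  then have "{x, y} \<in> closed_hyperspace Z"
    unfolding closed_hyperspace_def using closedin_Hausdorff_finite[OF haus, of "{x, y}"] by simp
  from sel[OF this] show "(x \<noteq> y \<and> f {x, y} = x) \<or> (y \<noteq> x \<and> f {y, x} = y)"
    using xy(3) by (auto simp: insert_commute)
qed

lemma ex_selection_order:
  assumes "Hausdorff_space Z" "has_continuous_selection Z"
  shows "\<exists>R. selection_order Z R"
proof -
  obtain f where "continuous_map (vietoris_topology Z) Z f"
    "\<And>T. T \<in> closed_hyperspace Z \<Longrightarrow> f T \<in> T"
    using assms(2) unfolding has_continuous_selection_def by blast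
  then have "selection_order Z (\<lambda>x y. x \<noteq> y \<and> f {x, y} = x)"
    by (rule selection_order_of_selection[OF assms(1)])
  then show ?thesis
    by blast
qed

text \<open>The selected point \<open>q\<close> is the least point, so removing it leaves the
  connected ray above it. On finite sets the selection takes the least element. If some
  \<open>r\<close> were below \<open>q\<close>, the value on every finite set containing a suitable
  \<open>F\<close> would be above \<open>r\<close>, but the least element of
  \<open>insert r F\<close> is not.\<close>

lemma selection_of_connected_noncut:
  assumes haus: "Hausdorff_space Z" and conn: "connected_space Z"
    and cont: "continuous_map (vietoris_topology Z) Z f"
    and sel: "\<And>T. T \<in> closed_hyperspace Z \<Longrightarrow> f T \<in> T"
    and ne: "topspace Z \<noteq> {}"
  shows "connectedin Z (topspace Z - {f (topspace Z)})"
proof -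
  define R where "R x y \<longleftrightarrow> x \<noteq> y \<and> f {x, y} = x" for x y
  interpret selection_order Z R
    unfolding R_def using selection_order_of_selection[OF haus cont sel] .
  have hyp: "F \<in> closed_hyperspace Z" if "finite F" "F \<subseteq> topspace Z" "F \<noteq> {}" for F
    unfolding closed_hyperspace_def using closedin_Hausdorff_finite[OF haus] that by simp
  \<comment> \<open>The value cannot leave \<open>m\<close> while a new point moves from an old one within the connected ray above \<open>m\<close>.\<close>
  have min: "f (insert m F) = m"
    if "finite F" "F \<subseteq> {x \<in> topspace Z. R m x}" "m \<in> topspace Z" for m F
    using that
  proof (induction F)
    case empty
    then show ?case
      using sel[OF hyp, of "{m}"] by auto
  next
    case (insert y F)
    show ?case
    proof (cases "F = {}")
      case True
      then show ?thesis
        using insert.prems unfolding R_def by simp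
    next
      case False
      then obtain x where x: "x \<in> F" by blast
      let ?P = "{w \<in> topspace Z. R m w}"
      let ?g = "\<lambda>w. f (insert w (insert m F))"
      let ?S = "{w \<in> topspace Z. w \<noteq> m \<and> ?g w = m}"
      let ?T = "{w \<in> topspace Z. ?g w \<in> topspace Z - {m}}"
      have K: "finite (insert m F)" "insert m F \<subseteq> topspace Z"
        using insert by auto
      have "openin Z ?S"
        using openin_selection_eq[OF haus cont sel K] by blast
      moreover have "continuous_map Z Z ?g"
        using continuous_map_compose[OF continuous_map_insert_vietoris[OF haus K] cont] unfolding o_def .
      then have "openin Z ?T"
        by (rule openin_continuous_map_preimage)
          (use closedin_Hausdorff_singleton[OF haus insert.prems(2)] in blast)
      moreover have "?P \<subseteq> ?S \<union> ?T"
      proof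
        fix w assume w: "w \<in> ?P"
        then have "?g w \<in> insert w (insert m F)"
          by (intro sel hyp) (use K in auto)
        then have "?g w \<in> topspace Z"
          using w K by auto
        then show "w \<in> ?S \<union> ?T"
          using w unfolding R_def by auto
      qed
      moreover have "?S \<inter> ?T \<inter> ?P = {}"
        by blast
      \<comment> \<open>Inserting the old point \<open>x\<close> changes nothing, so the induction
        hypothesis gives the value \<open>m\<close> there.\<close>
      moreover have "x \<in> ?S \<inter> ?P"
      proof -
        have "?g x = f (insert m F)"
          using x by (simp add: insert_absorb insert_commute)
        then show ?thesis
          using insert x unfolding R_def by auto
      qed
      ultimately have "?T \<inter> ?P = {}"
        using connected_above[OF conn insert.prems(2)] unfolding connectedin by blast
      moreover have "y \<in> ?P"
        using insert.prems by blast
      ultimately have "?g y = m"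
        using \<open>?P \<subseteq> ?S \<union> ?T\<close> by blast
      then show ?thesis
        by (simp add: insert_commute)
    qed
  qed
  define q where "q = f (topspace Z)"
  have top: "topspace Z \<in> closed_hyperspace Z"
    using ne by (simp add: closed_hyperspace_def)
  then have q: "q \<in> topspace Z"
    unfolding q_def by (rule sel)
  have "R q r" if r: "r \<in> topspace Z" "r \<noteq> q" for r
  proof (rule ccontr)
    assume "\<not> R q r"
    then have "R r q"
      using total q r by blast
    let ?U = "{T \<in> topspace (vietoris_topology Z). f T \<in> {y \<in> topspace Z. R r y}}"
    have "openin (vietoris_topology Z) ?U"
      using cont open_above[OF r(1)] by (rule openin_continuous_map_preimage)
    moreover have "topspace Z \<in> ?U"
      using top q \<open>R r q\<close> unfolding q_def by simp
    ultimately obtain F where F: "finite F" "F \<subseteq> topspace Z"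
      and FU: "\<forall>T \<in> closed_hyperspace Z. F \<subseteq> T \<longrightarrow> T \<in> ?U"
      by (auto dest!: vietoris_neighbourhood_topspace)
    have G: "finite (insert r F)" "insert r F \<noteq> {}" "insert r F \<subseteq> topspace Z"
      using F r by auto
    then obtain m where m: "m \<in> insert r F" "\<forall>x \<in> insert r F. x = m \<or> R m x"
      using finite_has_least[OF conn] by blast
    have "f (insert m (insert r F - {m})) = m"
      by (rule min) (use G m in auto)
    then have "f (insert r F) = m"
      using m(1) by (simp add: insert_absorb)
    then have "R r m"
      using FU hyp[OF G(1,3,2)] by auto
    moreover have "m \<in> topspace Z" "m = r \<or> R m r"
      using m G(3) by auto
    ultimately show False
      using asym[OF r(1)] irrefl[OF r(1)] by auto
  qed
  then have "topspace Z - {q} = {y \<in> topspace Z. R q y}"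
    using irrefl[OF q] by blast
  then show ?thesis
    using connected_above[OF conn q] unfolding q_def by simp
qed

lemma connectedin_selection_noncut:
  assumes "Hausdorff_space X" "connectedin X M" "M \<noteq> {}" "has_continuous_selection (subtopology X M)"
  shows "\<exists>q \<in> M. connectedin X (M - {q})"
proof -
  have top: "topspace (subtopology X M) = M"
    using assms(2) connectedin_subset_topspace by fastforce
  obtain f where f: "continuous_map (vietoris_topology (subtopology X M)) (subtopology X M) f"
    "\<And>T. T \<in> closed_hyperspace (subtopology X M) \<Longrightarrow> f T \<in> T"
    using assms(4) unfolding has_continuous_selection_def by blast
  have "connectedin (subtopology X M) (M - {f M})"
    using selection_of_connected_noncut[OF Hausdorff_space_subtopology[OF assms(1)] _ f] assms(2,3)
    unfolding top connectedin_def by blast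
  moreover have "M \<in> closed_hyperspace (subtopology X M)"
    unfolding closed_hyperspace_def using assms(3) closedin_topspace[of "subtopology X M"] top by simp
  ultimately show ?thesis
    using f(2) by (auto simp: connectedin_subtopology)
qed


section \<open>Selections on punctured spaces\<close>

lemma selection_of_punctured_closed:
  assumes "has_continuous_selection (subtopology X (topspace X - S))"
    and "closedin (subtopology X (topspace X - S)) C"
  shows "has_continuous_selection (subtopology X C)"
proof -
  have "C \<subseteq> topspace X - S"
    using closedin_subset[OF assms(2)] by simp
  then have "subtopology (subtopology X (topspace X - S)) C = subtopology X C"
    by (simp add: subtopology_subtopology Int_absorb1)
  then show ?thesis
    using has_continuous_selection_closed_subspace[OF assms] by simp
qed

text \<open>Selections enter three times. Puncturing at \<open>p\<close> orders \<open>J\<close>.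
  Puncturing at two points \<open>x\<close>, \<open>y\<close> of \<open>J\<close> forces
  \<open>p\<close> into the closure of the interval between them. Puncturing at a point
  \<open>u\<close> of \<open>J\<close> orders \<open>J \<union> {p}\<close> without
  \<open>u\<close>. This last order must have a cut point among any three points, yet removing two
  points of \<open>J\<close> leaves \<open>J \<union> {p}\<close> connected through
  \<open>p\<close>.\<close>

lemma no_connected_closed_in_puncture:
  fixes X :: "'a topology"
  assumes haus: "Hausdorff_space X"
    and sel: "\<And>S. \<lbrakk>S \<subseteq> topspace X; S \<noteq> {}; finite S; card S \<le> 2\<rbrakk>
        \<Longrightarrow> has_continuous_selection (subtopology X (topspace X - S))"
    and p: "p \<in> topspace X"
    and J: "closedin (subtopology X (topspace X - {p})) J" "connectedin X J"
    and a: "a \<in> J" and b: "b \<in> J" and "a \<noteq> b"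
  shows False
proof -
  have JX: "J \<subseteq> topspace X - {p}"
    using closedin_subset[OF J(1)] by simp
  define Y where "Y = subtopology X J"
  have top: "topspace Y = J"
    unfolding Y_def using JX by auto
  have conn: "connected_space Y"
    unfolding Y_def using J(2) by (simp add: connectedin_def)
  have "has_continuous_selection Y"
    unfolding Y_def using selection_of_punctured_closed[OF sel J(1)] p by simp
  then obtain R where "selection_order Y R"
    using ex_selection_order Hausdorff_space_subtopology[OF haus] unfolding Y_def by blast
  then interpret selection_order Y R .
  obtain C where C: "closedin X C" "J = C \<inter> (topspace X - {p})"
    using J(1) unfolding closedin_subtopology by blast
  \<comment> \<open>Otherwise the interval \<open>M\<close> is closed in \<open>X\<close> without
    \<open>x\<close> and \<open>y\<close>, so it has a selection and a non-cut point
    \<open>q\<close>; but there are points of \<open>M\<close> on both sides of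
    \<open>q\<close>.\<close>
  have limit: "p \<in> X closure_of {z \<in> J. R x z \<and> R z y}"
    if x: "x \<in> J" and y: "y \<in> J" and "R x y" for x y
  proof (rule ccontr)
    define M where "M = {z \<in> J. R x z \<and> R z y}"
    assume "p \<notin> X closure_of {z \<in> J. R x z \<and> R z y}"
    then have pM: "p \<notin> X closure_of M"
      unfolding M_def .
    have MJ: "M \<subseteq> J"
      unfolding M_def by blast
    have "connectedin Y M"
      using connected_between[OF conn _ _ \<open>R x y\<close>] x y unfolding top M_def by simp
    then have connM: "connectedin X M"
      unfolding Y_def connectedin_subtopology by blast
    have neM: "M \<noteq> {}"
      using between_nonempty[OF conn _ _ \<open>R x y\<close>] x y unfolding top M_def by blast
    \<comment> \<open>The closure of \<open>M\<close> lies in \<open>C\<close> and in a closed set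
      \<open>D\<close> that meets \<open>J\<close> in the closed interval. Since it misses
      \<open>p\<close>, it can add only \<open>x\<close> and \<open>y\<close> to
      \<open>M\<close>.\<close>
    have "closedin Y ({z \<in> topspace Y. z = x \<or> R x z} \<inter> {z \<in> topspace Y. z = y \<or> R z y})"
      using closed_atleast[of x] closed_atmost[of y] x y unfolding top by blast
    then obtain D where D: "closedin X D"
      "{z \<in> J. z = x \<or> R x z} \<inter> {z \<in> J. z = y \<or> R z y} = D \<inter> J"
      unfolding top unfolding Y_def closedin_subtopology by blast
    have "M \<subseteq> D"
      unfolding M_def using D(2) by blast
    then have clD: "X closure_of M \<subseteq> D"
      using D(1) by (rule closure_of_minimal)
    have clC: "X closure_of M \<subseteq> C"
      using MJ C by (intro closure_of_minimal) auto
    have "M = X closure_of M \<inter> (topspace X - {x, y})"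
    proof (intro equalityI subsetI)
      fix z assume z: "z \<in> X closure_of M \<inter> (topspace X - {x, y})"
      then have "z \<in> J"
        using clC pM C(2) by auto
      then have "z \<in> {z \<in> J. z = x \<or> R x z} \<inter> {z \<in> J. z = y \<or> R z y}"
        using z clD D(2) by auto
      then show "z \<in> M"
        unfolding M_def using z by auto
    next
      fix z assume z: "z \<in> M"
      then have "z \<in> X closure_of M"
        using closure_of_subset[of M X] MJ JX by auto
      moreover have "z \<noteq> x" "z \<noteq> y"
        using z irrefl x y unfolding M_def top by auto
      ultimately show "z \<in> X closure_of M \<inter> (topspace X - {x, y})"
        using z MJ JX by auto
    qed
    then have "closedin (subtopology X (topspace X - {x, y})) M"
      unfolding closedin_subtopology using closedin_closure_of by metis
    moreover have "has_continuous_selection (subtopology X (topspace X - {x, y}))"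
      by (rule sel) (use x y JX in \<open>auto simp: card_insert_if\<close>)
    ultimately have "has_continuous_selection (subtopology X M)"
      by (rule selection_of_punctured_closed[rotated])
    then obtain q where q: "q \<in> M" "connectedin X (M - {q})"
      using connectedin_selection_noncut[OF haus connM neM] by blast
    have qJ: "q \<in> topspace Y" "R x q" "R q y"
      using q(1) unfolding M_def top by auto
    obtain z1 where z1: "z1 \<in> topspace Y" "R x z1" "R z1 q"
      using between_nonempty[OF conn _ qJ(1,2)] x unfolding top by blast
    obtain z2 where z2: "z2 \<in> topspace Y" "R q z2" "R z2 y"
      using between_nonempty[OF conn qJ(1) _ qJ(3)] y unfolding top by blast
    have zM: "z1 \<in> M" "z2 \<in> M"
      using trans[OF conn z1(1) qJ(1) _ z1(3) qJ(3)] trans[OF conn _ qJ(1) z2(1) qJ(2) z2(2)] z1 z2 x y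
      unfolding M_def top by auto
    have topM: "topspace (subtopology Y M) = M"
      using MJ top by auto
    interpret M: selection_order "subtopology Y M" R
      by (rule subspace)
    have "\<not> connectedin (subtopology Y M) (M - {q})"
      using M.cut_of_between[of z1 q z2] zM q(1) z1 z2 unfolding topM by blast
    moreover have "subtopology Y M = subtopology X M"
      unfolding Y_def using MJ by (simp add: subtopology_subtopology Int_absorb1)
    ultimately show False
      using q(2) by (simp add: connectedin_subtopology)
  qed
  \<comment> \<open>A connected piece of \<open>J\<close> containing an interval has
    \<open>p\<close> in its closure, so adding \<open>p\<close> keeps it connected.\<close>
  have piece: "connectedin X (insert p P)"
    if P: "connectedin Y P" and xy: "x \<in> J" "y \<in> J" "R x y" "{z \<in> J. R x z \<and> R z y} \<subseteq> P" for P x y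
  proof (rule connectedin_intermediate_closure_of[where S = P])
    show "connectedin X P"
      using P unfolding Y_def connectedin_subtopology by blast
    then have "P \<subseteq> X closure_of P"
      by (intro closure_of_subset connectedin_subset_topspace)
    moreover have "p \<in> X closure_of P"
      using limit[OF xy(1-3)] closure_of_mono[OF xy(4), of X] by blast
    ultimately show "insert p P \<subseteq> X closure_of P"
      by blast
  qed blast
  \<comment> \<open>Removing \<open>x\<close> and \<open>z\<close> leaves two rays and an interval,
    glued together at \<open>p\<close>; an empty ray contributes just \<open>{p}\<close>.\<close>
  have conn1: "connectedin X (insert p J - {x, z})" if x: "x \<in> J" and z: "z \<in> J" and "R x z" for x z
  proof -
    have xt: "x \<in> topspace Y" and zt: "z \<in> topspace Y"
      using x z top by auto
    let ?B = "{w \<in> J. R w x}" and ?I = "{w \<in> J. R x w \<and> R w z}" and ?A = "{w \<in> J. R z w}"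
    have single: "connectedin X {p}"
      using p by simp
    have "connectedin X (insert p ?B)"
    proof (cases "?B = {}")
      case False
      then obtain w where w: "w \<in> J" "R w x" by blast
      show ?thesis
        by (rule piece[OF _ w(1) x w(2)]) (use connected_below[OF conn xt] top in auto)
    qed (simp only: single)
    moreover have "connectedin X (insert p ?I)"
      by (rule piece[OF _ x z \<open>R x z\<close>]) (use connected_between[OF conn xt zt \<open>R x z\<close>] top in auto)
    moreover have "connectedin X (insert p ?A)"
    proof (cases "?A = {}")
      case False
      then obtain w where w: "w \<in> J" "R z w" by blast
      show ?thesis
        by (rule piece[OF _ z w]) (use connected_above[OF conn zt] top in auto)
    qed (simp only: single)
    ultimately have "connectedin X (\<Union>{insert p ?B, insert p ?I, insert p ?A})"
      by (intro connectedin_Union) auto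
    moreover have "\<Union>{insert p ?B, insert p ?I, insert p ?A} = insert p J - {x, z}"
    proof (intro equalityI subsetI)
      fix w assume w: "w \<in> insert p J - {x, z}"
      show "w \<in> \<Union>{insert p ?B, insert p ?I, insert p ?A}"
      proof (cases "w = p")
        case False
        then have "w \<in> J" "w \<in> topspace Y" "w \<noteq> x" "w \<noteq> z"
          using w top by auto
        then show ?thesis
          using total[OF _ xt, of w] total[OF _ zt, of w] by auto
      qed simp
    next
      fix w assume "w \<in> \<Union>{insert p ?B, insert p ?I, insert p ?A}"
      then consider "w = p" | "w \<in> ?B" | "w \<in> ?I" | "w \<in> ?A" by blast
      then show "w \<in> insert p J - {x, z}"
      proof cases
        case 1
        then show ?thesis using x z JX by auto
      next
        case 2
        then have "w \<noteq> x" "w \<noteq> z"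
          using irrefl[OF xt] asym[OF xt zt \<open>R x z\<close>] by auto
        then show ?thesis using 2 by simp
      next
        case 3
        then have "w \<noteq> x" "w \<noteq> z"
          using irrefl[OF xt] irrefl[OF zt] by auto
        then show ?thesis using 3 by simp
      next
        case 4
        then have "w \<noteq> x" "w \<noteq> z"
          using irrefl[OF zt] asym[OF xt zt \<open>R x z\<close>] by auto
        then show ?thesis using 4 by simp
      qed
    qed
    ultimately show ?thesis by simp
  qed
  have conn2: "connectedin X (insert p J - {z} - {x})" if "x \<in> J" "z \<in> J" "x \<noteq> z" for x z
  proof -
    have "insert p J - {z} - {x} = insert p J - {x, z}" "insert p J - {z} - {x} = insert p J - {z, x}"
      by blast+
    then show ?thesis
      using conn1[of x z] conn1[of z x] total[of x z] that unfolding top by metis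
  qed
  \<comment> \<open>Four distinct points of \<open>J\<close> are needed: \<open>u\<close> is removed
    to form \<open>K\<close>, and \<open>w1\<close>, \<open>w2\<close>, \<open>v\<close> are the
    candidates for its cut point.\<close>
  obtain u v where uv: "u \<in> J" "v \<in> J" "R u v"
    using total[of a b] a b \<open>a \<noteq> b\<close> unfolding top by blast
  obtain w1 where w1: "w1 \<in> J" "R u w1" "R w1 v"
    using between_nonempty[OF conn _ _ uv(3)] uv unfolding top by blast
  obtain w2 where w2: "w2 \<in> J" "R u w2" "R w2 w1"
    using between_nonempty[OF conn _ _ w1(2)] uv w1 unfolding top by blast
  have "R w2 v"
    using trans[OF conn _ _ _ w2(3) w1(3)] w1 w2 uv unfolding top by blast
  have distinct: "w1 \<noteq> u" "w2 \<noteq> u" "v \<noteq> u" "w1 \<noteq> w2" "w1 \<noteq> v" "w2 \<noteq> v"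
    using irrefl[unfolded top] uv w1 w2 \<open>R w2 v\<close> by metis+
  define K where "K = insert p J - {u}"
  \<comment> \<open>The complement of \<open>J \<union> {p}\<close> is open in the open subspace
    without \<open>p\<close>, so \<open>J \<union> {p}\<close> is closed in
    \<open>X\<close>.\<close>
  have "openin X (topspace X - {p} - J)"
  proof (rule openin_trans_full)
    show "openin (subtopology X (topspace X - {p})) (topspace X - {p} - J)"
      using J(1) unfolding closedin_def by (simp add: Int_absorb1)
    show "openin X (topspace X - {p})"
      using closedin_Hausdorff_singleton[OF haus p] by blast
  qed
  moreover have "topspace X - insert p J = topspace X - {p} - J"
    by blast
  ultimately have "closedin X (insert p J)"
    using JX p unfolding closedin_def by auto
  moreover have "K = insert p J \<inter> (topspace X - {u})"
    unfolding K_def using JX p by auto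
  ultimately have "closedin (subtopology X (topspace X - {u})) K"
    unfolding closedin_subtopology by blast
  moreover have "has_continuous_selection (subtopology X (topspace X - {u}))"
    by (rule sel) (use uv JX in auto)
  ultimately have "has_continuous_selection (subtopology X K)"
    by (rule selection_of_punctured_closed[rotated])
  then obtain R' where "selection_order (subtopology X K) R'"
    using ex_selection_order Hausdorff_space_subtopology[OF haus] by blast
  then interpret K: selection_order "subtopology X K" R' .
  have topK: "topspace (subtopology X K) = K"
    unfolding K_def using JX p by auto
  have "w1 \<in> K" "w2 \<in> K" "v \<in> K"
    unfolding K_def using w1 w2 uv distinct by auto
  then obtain w where w: "w \<in> {w1, w2, v}" "\<not> connectedin (subtopology X K) (K - {w})"
    using K.cut_point_among_three[of w1 w2 v] distinct unfolding topK by blast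
  have "connectedin X (K - {w})"
    unfolding K_def by (rule conn2) (use w(1) w1 w2 uv distinct in auto)
  then show False
    using w(2) by (simp add: connectedin_subtopology)
qed


section \<open>Total disconnectedness\<close>

text \<open>For the backward direction, the family consists of all clopen sets containing
  \<open>x\<close>; it is nonempty because the whole space belongs to it.\<close>

lemma totally_disconnected_space_alt:
  "totally_disconnected_space X \<longleftrightarrow>
    (\<forall>x \<in> topspace X. \<forall>y \<in> topspace X. x \<noteq> y \<longrightarrow>
      (\<exists>C. openin X C \<and> closedin X C \<and> x \<in> C \<and> y \<notin> C))" (is "_ \<longleftrightarrow> ?rhs")
proof
  assume td: "totally_disconnected_space X"
  show ?rhs
  proof (intro ballI impI)
    fix x y assume "x \<in> topspace X" "y \<in> topspace X" "x \<noteq> y"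
    then obtain \<C> where \<C>: "\<forall>U \<in> \<C>. openin X U \<and> closedin X U" "{x} = \<Inter>\<C>"
      using td unfolding totally_disconnected_space_def by meson
    have "y \<notin> \<Inter>\<C>"
      using \<open>x \<noteq> y\<close> unfolding \<C>(2)[symmetric] by simp
    then obtain C where "C \<in> \<C>" "y \<notin> C"
      by blast
    moreover have "x \<in> \<Inter>\<C>"
      unfolding \<C>(2)[symmetric] by simp
    ultimately show "\<exists>C. openin X C \<and> closedin X C \<and> x \<in> C \<and> y \<notin> C"
      using \<C>(1) by blast
  qed
next
  assume sep: ?rhs
  show "totally_disconnected_space X"
    unfolding totally_disconnected_space_def
  proof
    fix x assume x: "x \<in> topspace X"
    let ?\<C> = "{C. openin X C \<and> closedin X C \<and> x \<in> C}"
    have "topspace X \<in> ?\<C>"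
      using x by simp
    moreover have "{x} = \<Inter>?\<C>"
    proof (intro equalityI subsetI)
      fix y assume y: "y \<in> \<Inter>?\<C>"
      then have "y \<in> topspace X"
        using \<open>topspace X \<in> ?\<C>\<close> by blast
      then show "y \<in> {x}"
        using sep x y by blast
    qed blast
    ultimately show "\<exists>\<C>. \<C> \<noteq> {} \<and> (\<forall>U \<in> \<C>. openin X U \<and> closedin X U) \<and> {x} = \<Inter>\<C>"
      by (intro exI[of _ ?\<C>]) blast
  qed
qed

section \<open>Countable clopen covers of punctured spaces\<close>

text \<open>If \<open>p\<close> is not in the closure of the ray \<open>U\<close> below it, then
  \<open>U\<close> is clopen. Otherwise tightness gives a countable \<open>A \<subseteq> U\<close>
  with \<open>p\<close> in its closure, and the sets \<open>U - E a\<close> form the cover: a point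
  \<open>x\<close> of \<open>U\<close> lying in every \<open>E a\<close> would be above all of
  \<open>A\<close>, although the ray above \<open>x\<close> is a neighbourhood of \<open>p\<close>
  and meets \<open>A\<close>.\<close>

lemma (in selection_order) countable_clopen_cover_below:
  assumes td: "totally_disconnected_space X" and tight: "countably_tight_space X"
    and p: "p \<in> topspace X"
  shows "\<exists>\<D>. countable \<D> \<and> (\<forall>D \<in> \<D>. openin X D \<and> closedin X D) \<and> \<Union>\<D> = {y \<in> topspace X. R y p}"
proof -
  define U where "U = {y \<in> topspace X. R y p}"
  have openU: "openin X U"
    unfolding U_def using p by (rule open_below)
  have closed: "closedin X (insert p U)"
  proof -
    have "insert p U = {y \<in> topspace X. y = p \<or> R y p}"
      unfolding U_def using p by blast
    then show ?thesis
      using closed_atmost[OF p] by simp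
  qed
  have clU: "X closure_of U \<subseteq> insert p U"
    using closed by (intro closure_of_minimal) auto
  show ?thesis
  proof (cases "p \<in> X closure_of U")
    case False
    then have "X closure_of U \<subseteq> U"
      using clU by blast
    then have "closedin X U"
      using openin_subset[OF openU] closure_of_subset_eq by blast
    then show ?thesis
      using openU unfolding U_def by (intro exI[of _ "{{y \<in> topspace X. R y p}}"]) simp
  next
    case True
    then obtain A where A: "A \<subseteq> U" "countable A" "p \<in> X closure_of A"
      using tight openin_subset[OF openU] unfolding countably_tight_space_def by meson
    have "\<exists>C. openin X C \<and> closedin X C \<and> p \<in> C \<and> a \<notin> C" if "a \<in> A" for a
    proof -
      have "a \<in> topspace X" "p \<noteq> a"
        using that A(1) irrefl[OF p] unfolding U_def by auto
      then show ?thesis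
        using td p unfolding totally_disconnected_space_alt by simp
    qed
    then obtain C where C: "\<And>a. a \<in> A \<Longrightarrow> openin X (C a) \<and> closedin X (C a) \<and> p \<in> C a \<and> a \<notin> C a"
      by metis
    \<comment> \<open>Because \<open>a \<notin> C a\<close>, the open and the closed ray above
      \<open>a\<close> have the same trace on \<open>C a\<close>, which makes \<open>E a\<close>
      clopen.\<close>
    define E where "E a = C a \<inter> {y \<in> topspace X. R a y}" for a
    have E: "openin X (E a) \<and> closedin X (E a) \<and> p \<in> E a" if a: "a \<in> A" for a
    proof -
      have at: "a \<in> topspace X" "R a p"
        using a A(1) unfolding U_def by auto
      have "E a = C a \<inter> {y \<in> topspace X. y = a \<or> R a y}"
        unfolding E_def using C[OF a] by blast
      then have "closedin X (E a)"
        using closed_atleast[OF at(1)] C[OF a] by (simp add: closedin_Int)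
      moreover have "openin X (E a)"
        unfolding E_def using open_above[OF at(1)] C[OF a] by (simp add: openin_Int)
      ultimately show ?thesis
        using C[OF a] at p unfolding E_def by simp
    qed
    have clopen: "openin X (U - E a) \<and> closedin X (U - E a)" if a: "a \<in> A" for a
    proof -
      \<comment> \<open>\<open>U\<close> itself need not be closed, but \<open>insert p U\<close>
        is, and \<open>p \<in> E a\<close> is removed again.\<close>
      have "U - E a = insert p U - E a"
        using E[OF a] by blast
      then show ?thesis
        using openin_diff[OF openU, of "E a"] closedin_diff[OF closed, of "E a"] E[OF a] by simp
    qed
    have "\<exists>a \<in> A. x \<notin> E a" if x: "x \<in> U" for x
    proof (rule ccontr)
      assume "\<not> ?thesis"
      then have above: "R a x" if "a \<in> A" for a
        using that unfolding E_def by blast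
      have xt: "x \<in> topspace X" "R x p"
        using x unfolding U_def by auto
      then have "p \<in> {y \<in> topspace X. R x y}"
        using p by simp
      then obtain a where a: "a \<in> A" "a \<in> {y \<in> topspace X. R x y}"
        using A(3) open_above[OF xt(1)] unfolding in_closure_of by meson
      then show False
        using above[OF a(1)] asym[OF xt(1), of a] by simp
    qed
    then have "\<Union>((\<lambda>a. U - E a) ` A) = U"
      by blast
    then show ?thesis
      using clopen A(2) unfolding U_def[symmetric]
      by (intro exI[of _ "(\<lambda>a. U - E a) ` A"]) auto
  qed
qed

lemma (in selection_order) countable_clopen_cover_puncture:
  assumes "totally_disconnected_space X" "countably_tight_space X" and p: "p \<in> topspace X"
  shows "\<exists>\<D>. countable \<D> \<and> (\<forall>D \<in> \<D>. openin X D \<and> closedin X D) \<and> \<Union>\<D> = topspace X - {p}"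
proof -
  obtain \<D> where "countable \<D>" "\<forall>D \<in> \<D>. openin X D \<and> closedin X D" "\<Union>\<D> = {y \<in> topspace X. R y p}"
    using countable_clopen_cover_below[OF assms] by (elim exE conjE)
  moreover obtain \<E> where "countable \<E>" "\<forall>D \<in> \<E>. openin X D \<and> closedin X D" "\<Union>\<E> = {y \<in> topspace X. R p y}"
    using selection_order.countable_clopen_cover_below[OF dual assms] by (elim exE conjE)
  moreover have "topspace X - {p} = {y \<in> topspace X. R y p} \<union> {y \<in> topspace X. R p y}"
    using total[OF p] irrefl[OF p] by blast
  ultimately show ?thesis
    by (intro exI[of _ "\<D> \<union> \<E>"]) (simp add: ball_Un)
qed

text \<open>Each further puncture replaces the cover by its pairwise intersections with a cover of
  the complement of the new point.\<close>

lemma (in selection_order) countable_clopen_cover_finite_puncture: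
  assumes td: "totally_disconnected_space X" and tight: "countably_tight_space X"
    and "finite S" "S \<subseteq> topspace X"
  shows "\<exists>\<D>. countable \<D> \<and> (\<forall>D \<in> \<D>. openin X D \<and> closedin X D) \<and> \<Union>\<D> = topspace X - S"
  using assms(3,4)
proof (induction S)
  case empty
  then show ?case
    by (intro exI[of _ "{topspace X}"]) simp
next
  case (insert p S)
  then obtain \<D> where D: "countable \<D>" "\<forall>D \<in> \<D>. openin X D \<and> closedin X D" "\<Union>\<D> = topspace X - S"
    by auto
  obtain \<E> where E: "countable \<E>" "\<forall>D \<in> \<E>. openin X D \<and> closedin X D" "\<Union>\<E> = topspace X - {p}"
    using countable_clopen_cover_puncture[OF td tight, of p] insert.prems by auto
  have "\<Union>((\<lambda>(D, E). D \<inter> E) ` (\<D> \<times> \<E>)) = \<Union>\<D> \<inter> \<Union>\<E>"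
    by auto
  also have "\<dots> = topspace X - insert p S"
    using D(3) E(3) by blast
  finally show ?case
    using D(1,2) E(1,2) by (intro exI[of _ "(\<lambda>(D, E). D \<inter> E) ` (\<D> \<times> \<E>)"]) auto
qed

text \<open>The members of the clopen cover are closed in \<open>X\<close> and inherit its
  selection; \<open>has_continuous_selection_countable_clopen_cover\<close> glues these
  together.\<close>

lemma has_continuous_selection_finite_puncture:
  assumes haus: "Hausdorff_space X" and tight: "countably_tight_space X"
    and td: "totally_disconnected_space X" and sel: "has_continuous_selection X"
    and S: "finite S" "S \<subseteq> topspace X"
  shows "has_continuous_selection (subtopology X (topspace X - S))"
proof -
  obtain R where "selection_order X R"
    using ex_selection_order[OF haus sel] by blast
  from selection_order.countable_clopen_cover_finite_puncture[OF this td tight S]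
  obtain \<D> where D: "countable \<D>" "\<forall>D \<in> \<D>. openin X D \<and> closedin X D" "\<Union>\<D> = topspace X - S"
    by (elim exE conjE)
  \<comment> \<open>Adding the empty set guarantees an enumeration by natural numbers even if
    \<open>\<D>\<close> is empty.\<close>
  define D where "D = from_nat_into (insert {} \<D>)"
  have range: "range D = insert {} \<D>"
    unfolding D_def using D(1) by (intro range_from_nat_into) auto
  have clopen: "openin X (D n)" "closedin X (D n)" "D n \<subseteq> topspace X - S" for n
  proof -
    have "D n \<in> insert {} \<D>"
      using range by blast
    then show "openin X (D n)" "closedin X (D n)" "D n \<subseteq> topspace X - S"
      using D(2,3) by auto
  qed
  show ?thesis
  proof (rule has_continuous_selection_countable_clopen_cover[of _ D])
    fix n
    show "openin (subtopology X (topspace X - S)) (D n)"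
      using clopen[of n] by (metis inf.absorb1 openin_subtopology)
    show "closedin (subtopology X (topspace X - S)) (D n)"
      using clopen[of n] by (metis inf.absorb1 closedin_subtopology)
    have "subtopology (subtopology X (topspace X - S)) (D n) = subtopology X (D n)"
      using clopen(3)[of n] by (simp add: subtopology_subtopology Int_absorb1)
    then show "has_continuous_selection (subtopology (subtopology X (topspace X - S)) (D n))"
      using has_continuous_selection_closed_subspace[OF sel clopen(2)] by simp
  next
    have "(\<Union>n. D n) = topspace X - S"
      using range D(3) by simp
    then show "topspace (subtopology X (topspace X - S)) = (\<Union>n. D n)"
      by auto
  qed
qed

section \<open>From punctured selections back to the whole space\<close>

lemma has_continuous_selection_clopen_Un:
  assumes C: "openin X C" "closedin X C"
    and sel: "has_continuous_selection (subtopology X C)"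
      "has_continuous_selection (subtopology X (topspace X - C))"
  shows "has_continuous_selection X"
proof (rule has_continuous_selection_countable_clopen_cover)
  \<comment> \<open>The gluing lemma takes a sequence, so the complement is repeated at all positive
    indices.\<close>
  let ?D = "\<lambda>n::nat. if n = 0 then C else topspace X - C"
  show "topspace X = (\<Union>n. ?D n)"
    using openin_subset[OF C(1)] by (auto split: if_splits)
qed (use assms in auto)

text \<open>Puncturing at a third point \<open>p\<close> may create a separation of \<open>a\<close>
  and \<open>b\<close>. If it does not, they lie in a connected set closed in the punctured space.
  If it does, by \<open>H\<close> say, then \<open>Y\<close>, that is \<open>H\<close> with
  \<open>p\<close> added, is closed in \<open>X\<close> and misses \<open>b\<close>. Now
  \<open>a\<close> and \<open>p\<close> cannot be separated in \<open>Y\<close>, which gives a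
  connected set closed in \<open>X\<close> without \<open>b\<close>.\<close>

lemma totally_disconnected_if_punctured_selections:
  assumes inf: "infinite (topspace X)" and haus: "Hausdorff_space X"
    and sel: "\<And>S. \<lbrakk>S \<subseteq> topspace X; S \<noteq> {}; finite S; card S \<le> 2\<rbrakk>
        \<Longrightarrow> has_continuous_selection (subtopology X (topspace X - S))"
  shows "totally_disconnected_space X"
proof (rule ccontr)
  assume "\<not> ?thesis"
  then obtain a b where a: "a \<in> topspace X" and b: "b \<in> topspace X" and "a \<noteq> b"
    and unsep: "\<And>C. \<lbrakk>openin X C; closedin X C; a \<in> C\<rbrakk> \<Longrightarrow> b \<in> C"
    unfolding totally_disconnected_space_alt by blast
  have noJ: False if "p \<in> topspace X" "closedin (subtopology X (topspace X - {p})) J" "connectedin X J"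
      "c \<in> J" "d \<in> J" "c \<noteq> d" for p J c d
    using no_connected_closed_in_puncture[OF haus sel that] by blast
  have "infinite (topspace X - {a, b})"
    using inf by simp
  then obtain p where p: "p \<in> topspace X" "p \<noteq> a" "p \<noteq> b"
    by (metis Diff_iff finite.emptyI insertCI ex_in_conv)
  define Z where "Z = subtopology X (topspace X - {p})"
  have topZ: "topspace Z = topspace X - {p}"
    unfolding Z_def by auto
  have openZ: "openin X (topspace X - {p})"
    using closedin_Hausdorff_singleton[OF haus p(1)] by blast
  have "has_continuous_selection Z" "Hausdorff_space Z"
    unfolding Z_def using sel[of "{p}"] p(1) Hausdorff_space_subtopology[OF haus] by auto
  then obtain R where "selection_order Z R"
    using ex_selection_order by blast
  then interpret Z: selection_order Z R .
  show False
  proof (cases "\<forall>C. openin Z C \<longrightarrow> closedin Z C \<longrightarrow> a \<in> C \<longrightarrow> b \<in> C")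
    case True
    then obtain J where "closedin Z J" "connectedin Z J" "a \<in> J" "b \<in> J"
      using Z.unseparated_in_connected[of a b] a b p \<open>a \<noteq> b\<close> unfolding topZ by blast
    then show False
      using noJ[OF p(1)] \<open>a \<noteq> b\<close> unfolding Z_def by (auto simp: connectedin_subtopology)
  next
    case False
    then obtain H where H: "openin Z H" "closedin Z H" "a \<in> H" "b \<notin> H"
      by blast
    have HX: "H \<subseteq> topspace X - {p}"
      using openin_subset[OF H(1)] topZ by simp
    have openH: "openin X H"
      using H(1) openZ unfolding Z_def by (rule openin_trans_full)
    define Y where "Y = insert p H"
    have closedY: "closedin X Y"
    proof -
      have "openin X (topspace X - {p} - H)"
        using H(2) topZ openZ openin_trans_full unfolding closedin_def Z_def by metis
      moreover have "topspace X - Y = topspace X - {p} - H"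
        unfolding Y_def by blast
      ultimately show ?thesis
        using HX p(1) unfolding closedin_def Y_def by auto
    qed
    have closedYb: "closedin (subtopology X (topspace X - {b})) T" if "closedin X T" "T \<subseteq> Y" for T
    proof -
      have "T \<subseteq> topspace X - {b}"
        using that H(4) p HX unfolding Y_def by auto
      then show ?thesis
        using that(1) by (metis closedin_subtopology inf.absorb1)
    qed
    have "has_continuous_selection (subtopology X (topspace X - {b}))"
      using sel[of "{b}"] b by simp
    then have "has_continuous_selection (subtopology X Y)"
      using selection_of_punctured_closed closedYb[OF closedY] by blast
    then obtain R' where "selection_order (subtopology X Y) R'"
      using ex_selection_order Hausdorff_space_subtopology[OF haus] by blast
    then interpret Y: selection_order "subtopology X Y" R' .
    have topY: "topspace (subtopology X Y) = Y"
      using closedin_subset[OF closedY] by auto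
    \<comment> \<open>A clopen set of \<open>Y\<close> missing \<open>p\<close> is open in the open
      set \<open>H\<close>, hence clopen in \<open>X\<close>, and would separate \<open>a\<close>
      from \<open>b\<close>.\<close>
    have unsepY: "p \<in> C" if C: "openin (subtopology X Y) C" "closedin (subtopology X Y) C" "a \<in> C" for C
    proof (rule ccontr)
      assume "p \<notin> C"
      have "closedin X C"
        using C(2) closedY by (rule closedin_trans_full)
      obtain O' where O': "openin X O'" "C = O' \<inter> Y"
        using C(1) unfolding openin_subtopology by blast
      then have "C = O' \<inter> H"
        using \<open>p \<notin> C\<close> unfolding Y_def by blast
      then have "openin X C"
        using O'(1) openH by (simp add: openin_Int)
      then have "b \<in> C"
        using unsep \<open>closedin X C\<close> C(3) by blast
      then show False
        using \<open>C = O' \<inter> H\<close> H(4) by blast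
    qed
    have aY: "a \<in> topspace (subtopology X Y)" and pY: "p \<in> topspace (subtopology X Y)"
      unfolding topY unfolding Y_def using H(3) by auto
    have "\<exists>J. closedin (subtopology X Y) J \<and> connectedin (subtopology X Y) J \<and> a \<in> J \<and> p \<in> J"
      by (rule Y.unseparated_in_connected[OF aY pY p(2)[symmetric]]) (rule unsepY)
    then obtain J where J: "closedin (subtopology X Y) J" "connectedin (subtopology X Y) J" "a \<in> J" "p \<in> J"
      by (elim exE conjE)
    have "closedin X J" "J \<subseteq> Y"
      using closedin_trans_full[OF J(1) closedY] closedin_subset[OF J(1)] topY by simp_all
    moreover have "connectedin X J"
      using J(2) unfolding connectedin_subtopology by blast
    ultimately show False
      using noJ[OF b closedYb[of J] _ J(3,4)] p(2) by simp
  qed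
qed

theorem corollary4p4:
  fixes X :: "'a topology"
  assumes "infinite (topspace X)"
    and "Hausdorff_space X"
    and "countably_tight_space X"
  shows "(totally_disconnected_space X \<and> has_continuous_selection X) \<longleftrightarrow>
         (\<forall>S. S \<subseteq> topspace X \<and> S \<noteq> {} \<and> finite S \<and> card S \<le> 2 \<longrightarrow>
              has_continuous_selection (subtopology X (topspace X - S)))"
    (is "?L \<longleftrightarrow> ?R")
proof
  assume ?L
  then show ?R
    using has_continuous_selection_finite_puncture[OF assms(2,3)] by blast
next
  assume R: ?R
  then have td: "totally_disconnected_space X"
    using totally_disconnected_if_punctured_selections[OF assms(1,2)] by blast
  obtain a where a: "a \<in> topspace X"
    using assms(1) by (metis finite.emptyI ex_in_conv)
  have "infinite (topspace X - {a})"
    using assms(1) by simp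
  then obtain b where b: "b \<in> topspace X" "a \<noteq> b"
    by (metis Diff_iff finite.emptyI insertCI ex_in_conv)
  obtain C where C: "openin X C" "closedin X C" "a \<in> C" "b \<notin> C"
    using td a b unfolding totally_disconnected_space_alt by blast
  have sel: "has_continuous_selection (subtopology X T)"
    if "closedin X T" "x \<in> topspace X" "x \<notin> T" for T x
  proof (rule selection_of_punctured_closed[of X "{x}"])
    show "has_continuous_selection (subtopology X (topspace X - {x}))"
      using R that(2) by simp
    have "T \<subseteq> topspace X - {x}"
      using closedin_subset[OF that(1)] that(3) by blast
    then show "closedin (subtopology X (topspace X - {x})) T"
      using that(1) by (metis closedin_subtopology inf.absorb1)
  qed
  \<comment> \<open>\<open>C\<close> misses \<open>b\<close> and its complement misses
    \<open>a\<close>, so each is closed in a punctured space and inherits a selection from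
    it.\<close>
  have "has_continuous_selection (subtopology X C)"
    using C(2) b(1) C(4) by (rule sel)
  moreover have "closedin X (topspace X - C)"
    using C(1) by blast
  then have "has_continuous_selection (subtopology X (topspace X - C))"
    using a by (rule sel) (use C(3) in blast)
  ultimately show ?L
    using td has_continuous_selection_clopen_Un[OF C(1,2)] by blast
qed

end
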